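(* Assume the Axiom of Choice. For every poset $P$ there exists a chain $C \subseteq P$ with no strict upper bound in $P$.
   Context: A chain in a poset $P$ is a linearly ordered subset of $P$ (the empty set is a chain). For $C \subseteq P$, an element $s \in P$ is a strict upper bound of $C$ if $c < s$ for all $c \in C$. The Axiom of Choice is the statement: for every family $\{A_i \mid i \in I\}$ of nonempty sets, there exists a function $f : I \to \bigcup_{i \in I} A_i$ such that $f(i) \in A_i$ for all $i \in I$. *)

theory Defs
  imports Main "HOL-Library.FuncSet"
begin

text \<open>
  HOL cannot quantify over types inside a formula, so the Axiom of Choice is stated for families
  of sets over \<open>'a\<close> with index sets over \<open>'i\<close>. The type arguments only select the
  instance. Every instance is already provable in HOL, because of Hilbert's choice operator.
\<close>

definition axiom_of_choice :: "'i itself \<Rightarrow> 'a itself \<Rightarrow> bool" where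
  "axiom_of_choice _ _ \<longleftrightarrow>
    (\<forall>(I :: 'i set) (A :: 'i \<Rightarrow> 'a set). (\<forall>i\<in>I. A i \<noteq> {}) \<longrightarrow>
      (\<exists>f. f \<in> I \<rightarrow> (\<Union>i\<in>I. A i) \<and> (\<forall>i\<in>I. f i \<in> A i)))"

definition strict_upper_bound :: "'a set \<Rightarrow> 'a rel \<Rightarrow> 'a set \<Rightarrow> 'a \<Rightarrow> bool" where
  "strict_upper_bound P r C s \<longleftrightarrow> s \<in> P \<and> (\<forall>c\<in>C. (c, s) \<in> r \<and> c \<noteq> s)"

end

theory Submission
  imports Defs
begin

text \<open>
  A chain that is maximal under inclusion has no strict upper bound: adjoining such a bound would
  give a chain again, because the bound is comparable to every element, and a properly larger one,
  because the bound is not strictly above itself. Maximal chains exist by Hausdorff's maximal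
  principle, which is the form in which choice enters.
\<close>

theorem lemma6:
  fixes P :: "'a set" and r :: "'a rel"
  assumes "axiom_of_choice TYPE('a set) TYPE('a)"
    and "partial_order_on P r"
  shows "\<exists>C. C \<subseteq> P \<and> C \<in> Chains r \<and> (\<nexists>s. strict_upper_bound P r C s)"
proof -
  let ?R = "\<lambda>x y. (x, y) \<in> r"
  obtain C where max: "pred_on.maxchain P ?R C"
    using pred_on.Hausdorff by blast
  then have C: "pred_on.chain P ?R C"
    by (simp add: pred_on.maxchain_def)
  then have "C \<subseteq> P"
    by (simp add: pred_on.chain_def)
  moreover have "C \<in> Chains r"
  proof -
    \<comment> \<open>Chains in the sense of \<open>pred_on\<close> are compared by the reflexive closure of \<open>r\<close>, so
      reflexivity of \<open>r\<close> on \<open>P\<close> is what turns them into chains for \<open>r\<close> itself.\<close>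
    have "(x, x) \<in> r" if "x \<in> C" for x
      using assms(2) \<open>C \<subseteq> P\<close> that
      by (auto simp: partial_order_on_def preorder_on_def refl_on_def)
    then show ?thesis
      using C by (fastforce simp: pred_on.chain_def Chains_def)
  qed
  moreover have "\<not> strict_upper_bound P r C s" for s
  proof
    assume s: "strict_upper_bound P r C s"
    have "pred_on.chain P ?R (insert s C)"
      using C s by (auto simp: pred_on.chain_def strict_upper_bound_def)
    moreover have "C \<subset> insert s C"
      using s by (auto simp: strict_upper_bound_def)
    ultimately show False
      using max by (auto simp: pred_on.maxchain_def)
  qed
  ultimately show ?thesis
    by blast
qed

end
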